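(* Fix a real number $\lambda>0$. For a square real matrix $D$ let $T(D)=\dfrac{e^{\lambda D}-I}{e^{\lambda}-1}$ be its PWP matrix of indirect influences. Then: 1. If $D=0$, then $T(D)=0$. Moreover, $T(D^t)=T(D)^t$ for every square real matrix $D$, where $^t$ denotes transpose. 2. $T(QCQ^{-1})=Q\,T(C)\,Q^{-1}$ for every square real matrix $C$ and every invertible real matrix $Q$ of the same size. 3. If $D_1\oplus D_2\in M_m(\mathbb{R})\oplus M_n(\mathbb{R})\subseteq M_{m+n}(\mathbb{R})$, then $T(D_1\oplus D_2)=T(D_1)\oplus T(D_2)$. 4. If $D$ is a column stochastic matrix, then $T(D)$ is a column stochastic matrix. 5. If $D_1,D_2$ are square real matrices of the same size with $[D_1,D_2]=0$, then $$T(D_1+D_2)=(e^{\lambda}-1)\,T(D_1)T(D_2)+T(D_1)+T(D_2).$$ 6. Let $D\in M_n(\mathbb{R})$. Then $T(D)$ is the expected matrix of the random matrix $\widehat{D}$, where $\widehat{D}:\mathbb{N}_+\to M_n(\mathbb{R})$ is given by $\widehat{D}(k)=D^k$, and $\mathbb{N}_+$ is the probability space with probability function $p(k)=\dfrac{\lambda^k}{(e^{\lambda}-1)\,k!}$.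
   Context: $M_n(\mathbb{R})$ is the set of $n\times n$ real matrices and $I$ is the identity matrix of the appropriate size. $\mathbb{N}_+=\{1,2,3,\dots\}$. $e^{\lambda D}$ is the matrix exponential; equivalently, $T(D)=\frac{1}{e^{\lambda}-1}\sum_{k=1}^{\infty}\frac{(\lambda D)^k}{k!}$. $D_1\oplus D_2$ denotes the block diagonal matrix with blocks $D_1$ and $D_2$, and $[D_1,D_2]=D_1D_2-D_2D_1$. A square matrix $S$ is column stochastic if its entries are non-negative real numbers and $\sum_i S_{ij}=1$ for every column $j$. The expected matrix of a random matrix $\widehat{D}$ on $\mathbb{N}_+$ with probability function $p$ is $\sum_{k=1}^{\infty}\widehat{D}(k)\,p(k)$. *)

theory Defs
  imports "HOL-Analysis.Analysis" "HOL-Probability.Probability"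
begin

(* The library operations *, ^ and 1 on real^'n^'n act entrywise, so powers and the
   exponential of a matrix have to be built from ** and mat 1. *)

primrec matrix_power :: "real^'n^'n \<Rightarrow> nat \<Rightarrow> real^'n^'n" where
  "matrix_power A 0 = mat 1"
| "matrix_power A (Suc k) = A ** matrix_power A k"

definition matrix_exp :: "real^'n^'n \<Rightarrow> real^'n^'n" where
  "matrix_exp A = (\<Sum>k. (1 / fact k) *\<^sub>R matrix_power A k)"

definition pwp :: "real \<Rightarrow> real^'n^'n \<Rightarrow> real^'n^'n" where
  "pwp lam D = (1 / (exp lam - 1)) *\<^sub>R (matrix_exp (lam *\<^sub>R D) - mat 1)"

(* Rows and columns of the (m+n) x (m+n) block matrix are indexed by the disjoint sum of the
   two index types, which has CARD('m) + CARD('n) elements. *)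
definition block_sum :: "real^'m^'m \<Rightarrow> real^'n^'n \<Rightarrow> real^('m + 'n)^('m + 'n)" where
  "block_sum A B = (\<chi> i j. case i of
      Inl a \<Rightarrow> (case j of Inl b \<Rightarrow> A $ a $ b | Inr b \<Rightarrow> 0)
    | Inr a \<Rightarrow> (case j of Inl b \<Rightarrow> 0 | Inr b \<Rightarrow> B $ a $ b))"

definition commutator :: "real^'n^'n \<Rightarrow> real^'n^'n \<Rightarrow> real^'n^'n" where
  "commutator A B = A ** B - B ** A"

definition column_stochastic :: "real^'n^'n \<Rightarrow> bool" where
  "column_stochastic S \<longleftrightarrow> (\<forall>i j. 0 \<le> S $ i $ j) \<and> (\<forall>j. (\<Sum>i\<in>UNIV. S $ i $ j) = 1)"

definition pwp_prob :: "real \<Rightarrow> nat \<Rightarrow> real" where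
  "pwp_prob lam k = lam ^ k / ((exp lam - 1) * fact k)"

(* A random matrix on the positive integers is a function on nat whose value at 0 is ignored:
   the index shift makes the series run over k = 1, 2, 3, ... *)
definition expected_matrix :: "(nat \<Rightarrow> real^'n^'n) \<Rightarrow> (nat \<Rightarrow> real) \<Rightarrow> real^'n^'n" where
  "expected_matrix X p = (\<Sum>k. p (Suc k) *\<^sub>R X (Suc k))"

end

theory Submission
  imports Defs
begin

text \<open>
  Everything rests on the expansion
  \<open>T(D) = (\<Sum>k\<ge>1. p(k) D^k)\<close>, where \<open>p\<close> is a probability function on the positive
  integers. A linear map that carries the powers of \<open>C\<close> to the powers of \<open>D\<close> therefore carries
  \<open>T(C)\<close> to \<open>T(D)\<close>; this applies to transposition and conjugation, and entrywise to block sums.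
  Column stochasticity passes to \<open>T(D)\<close> because \<open>T(D)\<close> is a convex combination of
  the stochastic matrices \<open>D^k\<close>. The formula for commuting matrices is
  \<open>exp(A + B) = exp(A) exp(B)\<close>, which follows from the binomial theorem and the Cauchy
  product of the entry series.
\<close>

subsection \<open>The matrix exponential series\<close>

lemma bounded_bilinear_matrix_mult:
  \<comment> \<open>Bilinear maps on finite-dimensional spaces are bounded. The interpretation that
    follows supplies the algebraic rules for \<open>**\<close> and the constant in its norm
    estimate.\<close>
  "bounded_bilinear ((**) :: real^'n^'m \<Rightarrow> real^'p^'n \<Rightarrow> real^'p^'m)"
proof -
  have "bilinear ((**) :: real^'n^'m \<Rightarrow> real^'p^'n \<Rightarrow> real^'p^'m)"
    unfolding bilinear_def
    by (intro conjI allI linearI)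
       (simp_all add: vec_eq_iff matrix_matrix_mult_def algebra_simps sum.distrib sum_distrib_left)
  then show ?thesis
    by (simp add: bilinear_conv_bounded_bilinear)
qed

interpretation matrix_mult: bounded_bilinear "(**) :: real^'n^'m \<Rightarrow> real^'p^'n \<Rightarrow> real^'p^'m"
  by (rule bounded_bilinear_matrix_mult)

text \<open>The norm is submultiplicative for \<open>**\<close> up to a constant, so powers grow at
  most geometrically; this allows comparison with the scalar exponential series.\<close>

lemma norm_matrix_power_le:
  fixes A :: "real^'n^'n"
  obtains c K where "\<And>k. norm (matrix_power A k) \<le> c * K ^ k"
proof -
  obtain K where K: "0 < K" "\<And>(X :: real^'n^'n) (Y :: real^'n^'n). norm (X ** Y) \<le> norm X * norm Y * K"
    using matrix_mult.pos_bounded by blast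
  have "norm (matrix_power A k) \<le> norm (mat 1 :: real^'n^'n) * (norm A * K) ^ k" for k
  proof (induction k)
    case (Suc k)
    have "norm (matrix_power A (Suc k)) \<le> (norm A * K) * norm (matrix_power A k)"
      using K(2)[of A "matrix_power A k"] by (simp add: mult_ac)
    also have "\<dots> \<le> (norm A * K) * (norm (mat 1 :: real^'n^'n) * (norm A * K) ^ k)"
      using Suc K(1) by (intro mult_left_mono) auto
    finally show ?case
      by (simp add: mult_ac)
  qed simp
  then show thesis
    by (rule that)
qed

text \<open>Absorbing \<open>1 / fact k\<close> into the power removes the binomial coefficients
  from \<open>exp_term_add\<close>.\<close>

definition exp_term :: "real^'n^'n \<Rightarrow> nat \<Rightarrow> real^'n^'n" where
  "exp_term A k = (1 / fact k) *\<^sub>R matrix_power A k"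

lemma summable_norm_exp_term: "summable (\<lambda>k. norm (exp_term A k))"
proof -
  obtain c K where cK: "\<And>k. norm (matrix_power A k) \<le> c * K ^ k"
    using norm_matrix_power_le by blast
  have "summable (\<lambda>k. c * (inverse (fact k) * K ^ k))"
    by (intro summable_mult summable_exp)
  then show ?thesis
  proof (rule summable_comparison_test')
    show "norm (norm (exp_term A k)) \<le> c * (inverse (fact k) * K ^ k)" for k
      using cK[of k] by (simp add: exp_term_def field_simps)
  qed
qed

lemma exp_term_sums: "exp_term A sums matrix_exp A"
  using summable_sums[OF summable_norm_cancel[OF summable_norm_exp_term[of A]]]
  by (simp add: matrix_exp_def exp_term_def[abs_def])

lemma sums_matrix_nth: "f sums M \<Longrightarrow> (\<lambda>k. f k $ i $ j) sums (M $ i $ j)"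
  for M :: "real^'n^'m"
  by (intro sums_vec_nth)

text \<open>Absolute convergence of each entry series is what the Cauchy product in
  \<open>matrix_exp_add\<close> requires.\<close>

lemma summable_norm_exp_term_nth: "summable (\<lambda>k. norm (exp_term A k $ i $ j))"
proof (rule summable_comparison_test'[OF summable_norm_exp_term])
  show "norm (norm (exp_term A k $ i $ j)) \<le> norm (exp_term A k)" for k
    using Finite_Cartesian_Product.norm_nth_le[of "exp_term A k $ i" j]
      Finite_Cartesian_Product.norm_nth_le[of "exp_term A k" i] by simp
qed

lemma matrix_exp_zero: "matrix_exp (0 :: real^'n^'n) = mat 1"
proof -
  have "exp_term (0 :: real^'n^'n) = (\<lambda>k. if k = 0 then mat 1 else 0)"
  proof
    show "exp_term (0 :: real^'n^'n) k = (if k = 0 then mat 1 else 0)" for k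
      by (cases k) (simp_all add: exp_term_def matrix_mult.zero_left)
  qed
  then have "exp_term 0 sums (mat 1 :: real^'n^'n)"
    using sums_single[of 0 "\<lambda>_. mat 1 :: real^'n^'n"] by simp
  then show ?thesis
    by (rule sums_unique2[OF exp_term_sums])
qed

lemma matrix_power_scaleR: "matrix_power (c *\<^sub>R A) k = c ^ k *\<^sub>R matrix_power A k"
  by (induction k) (simp_all add: matrix_mult.scaleR_left matrix_mult.scaleR_right)

lemma matrix_power_commute:
  assumes "A ** B = B ** A"
  shows "matrix_power A k ** B = B ** matrix_power A k"
proof (induction k)
  case (Suc k)
  then show ?case
    by (metis assms matrix_mul_assoc matrix_power.simps(2))
qed simp

text \<open>This is the binomial theorem in divided powers. Multiplying the induction hypothesis by
  \<open>A + B\<close> gives two sums whose coefficients add up to \<open>Suc n\<close>.\<close>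

lemma exp_term_add:
  fixes A B :: "real^'n^'n"
  assumes comm: "A ** B = B ** A"
  shows "exp_term (A + B) n = (\<Sum>i\<le>n. exp_term A i ** exp_term B (n - i))"
proof (induction n)
  case 0
  show ?case
    by (simp add: exp_term_def)
next
  case (Suc n)
  let ?S = "exp_term :: real^'n^'n \<Rightarrow> nat \<Rightarrow> real^'n^'n"
  have times_S: "X ** ?S X k = real (Suc k) *\<^sub>R ?S X (Suc k)" for X k
    by (simp add: exp_term_def matrix_mult.scaleR_right del: of_nat_Suc)
  \<comment> \<open>Commutation moves \<open>B\<close> past the terms of \<open>A\<close>, next to
    its own terms.\<close>
  have S_comm: "B ** ?S A k = ?S A k ** B" for k
    by (simp add: exp_term_def matrix_mult.scaleR_right matrix_mult.scaleR_left
        matrix_power_commute[OF comm])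
  have "real (Suc n) *\<^sub>R ?S (A + B) (Suc n) = (A + B) ** (\<Sum>i\<le>n. ?S A i ** ?S B (n - i))"
    by (simp only: times_S[symmetric] Suc)
  also have "\<dots> = (\<Sum>i\<le>n. (A ** ?S A i) ** ?S B (n - i)) + (\<Sum>i\<le>n. (B ** ?S A i) ** ?S B (n - i))"
    by (simp add: matrix_mult.add_left matrix_mult.sum_right matrix_mul_assoc sum.distrib)
  also have "(\<Sum>i\<le>n. (B ** ?S A i) ** ?S B (n - i)) = (\<Sum>i\<le>n. ?S A i ** (B ** ?S B (n - i)))"
    by (simp add: S_comm matrix_mul_assoc)
  also have "(\<Sum>i\<le>n. (A ** ?S A i) ** ?S B (n - i)) + \<dots>
      = (\<Sum>i\<le>n. real (Suc i) *\<^sub>R (?S A (Suc i) ** ?S B (n - i)))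
        + (\<Sum>i\<le>n. real (Suc n - i) *\<^sub>R (?S A i ** ?S B (Suc n - i)))"
    by (simp add: times_S Suc_diff_le matrix_mult.scaleR_right matrix_mult.scaleR_left)
  \<comment> \<open>Shifting the index adds a term at \<open>i = 0\<close>, whose coefficient is
    zero.\<close>
  also have "(\<Sum>i\<le>n. real (Suc i) *\<^sub>R (?S A (Suc i) ** ?S B (n - i)))
      = (\<Sum>i\<le>Suc n. real i *\<^sub>R (?S A i ** ?S B (Suc n - i)))"
    by (subst sum.atMost_Suc_shift) simp
  \<comment> \<open>The added term at \<open>i = Suc n\<close> has coefficient zero as well.\<close>
  also have "(\<Sum>i\<le>n. real (Suc n - i) *\<^sub>R (?S A i ** ?S B (Suc n - i)))
      = (\<Sum>i\<le>Suc n. real (Suc n - i) *\<^sub>R (?S A i ** ?S B (Suc n - i)))"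
    by simp
  also have "(\<Sum>i\<le>Suc n. real i *\<^sub>R (?S A i ** ?S B (Suc n - i))) + \<dots>
      = (\<Sum>i\<le>Suc n. real (Suc n) *\<^sub>R (?S A i ** ?S B (Suc n - i)))"
    by (simp flip: sum.distrib scaleR_add_left of_nat_add)
  also have "\<dots> = real (Suc n) *\<^sub>R (\<Sum>i\<le>Suc n. ?S A i ** ?S B (Suc n - i))"
    by (simp only: scaleR_right.sum)
  finally show ?case
    by (simp del: sum.cl_ivl_Suc)
qed

text \<open>Each entry of the matrix product is a finite sum over \<open>l\<close> of products of
  real series, so Cauchy's theorem applies to each summand.\<close>

lemma matrix_exp_add:
  fixes A B :: "real^'n^'n"
  assumes "A ** B = B ** A"
  shows "matrix_exp (A + B) = matrix_exp A ** matrix_exp B"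
proof -
  have "matrix_exp (A + B) $ i $ j = (matrix_exp A ** matrix_exp B) $ i $ j" for i j
  proof -
    have "(\<lambda>k. \<Sum>m\<le>k. exp_term A m $ i $ l * exp_term B (k - m) $ l $ j)
        sums (matrix_exp A $ i $ l * matrix_exp B $ l $ j)" for l
      using Cauchy_product_sums[OF summable_norm_exp_term_nth[of A i l]
          summable_norm_exp_term_nth[of B l j]]
      by (simp add: sums_unique[OF sums_matrix_nth[OF exp_term_sums], symmetric])
    then have "(\<lambda>k. \<Sum>l\<in>UNIV. \<Sum>m\<le>k. exp_term A m $ i $ l * exp_term B (k - m) $ l $ j)
        sums (\<Sum>l\<in>UNIV. matrix_exp A $ i $ l * matrix_exp B $ l $ j)"
      by (intro sums_sum)
    moreover have "(\<Sum>l\<in>UNIV. \<Sum>m\<le>k. exp_term A m $ i $ l * exp_term B (k - m) $ l $ j)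
        = exp_term (A + B) k $ i $ j" for k
      by (subst sum.swap) (simp add: exp_term_add[OF assms] matrix_matrix_mult_def)
    ultimately have "(\<lambda>k. exp_term (A + B) k $ i $ j) sums ((matrix_exp A ** matrix_exp B) $ i $ j)"
      by (simp add: matrix_matrix_mult_def)
    then show ?thesis
      by (rule sums_unique2[OF sums_matrix_nth[OF exp_term_sums]])
  qed
  then show ?thesis
    by (simp add: vec_eq_iff)
qed

subsection \<open>The matrix of indirect influences as a power series\<close>

lemma pwp_sums:
  "(\<lambda>k. pwp_prob lam (Suc k) *\<^sub>R matrix_power D (Suc k)) sums pwp lam D"
proof -
  \<comment> \<open>Subtracting \<open>mat 1\<close> drops the term at index 0; the limit is split
    to fit \<open>sums_Suc_iff\<close>.\<close>
  have "exp_term (lam *\<^sub>R D) sums ((matrix_exp (lam *\<^sub>R D) - mat 1) + exp_term (lam *\<^sub>R D) 0)"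
    using exp_term_sums by (simp add: exp_term_def)
  then have "(\<lambda>k. exp_term (lam *\<^sub>R D) (Suc k)) sums (matrix_exp (lam *\<^sub>R D) - mat 1)"
    by (simp only: sums_Suc_iff)
  then have "(\<lambda>k. (1 / (exp lam - 1)) *\<^sub>R exp_term (lam *\<^sub>R D) (Suc k)) sums pwp lam D"
    unfolding pwp_def by (rule sums_scaleR_right)
  moreover have "(1 / (exp lam - 1)) *\<^sub>R exp_term (lam *\<^sub>R D) k = pwp_prob lam k *\<^sub>R matrix_power D k" for k
    by (simp add: exp_term_def pwp_prob_def matrix_power_scaleR)
  ultimately show ?thesis
    by simp
qed

section \<open>The weights as a probability function on the positive integers\<close>

lemma pwp_prob_nonneg: "0 < lam \<Longrightarrow> 0 \<le> pwp_prob lam k"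
  by (simp add: pwp_prob_def)

lemma pwp_prob_sums:
  assumes "0 < lam"
  shows "(\<lambda>k. pwp_prob lam (Suc k)) sums 1"
proof -
  have "(\<lambda>k. lam ^ k / fact k) sums ((exp lam - 1) + lam ^ 0 / fact 0)"
    using exp_converges[of lam] by (simp add: divide_inverse mult.commute)
  then have "(\<lambda>k. lam ^ Suc k / fact (Suc k)) sums (exp lam - 1)"
    by (simp only: sums_Suc_iff[of "\<lambda>k. lam ^ k / fact k"])
  then have "(\<lambda>k. lam ^ Suc k / fact (Suc k) / (exp lam - 1)) sums ((exp lam - 1) / (exp lam - 1))"
    by (rule sums_divide)
  with assms show ?thesis
    by (simp add: pwp_prob_def mult_ac)
qed

lemma prob_space_pwp_prob:
  assumes "0 < lam"
  shows "prob_space (point_measure {1..} (\<lambda>k. ennreal (pwp_prob lam k)))"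
proof
  let ?p = "\<lambda>k. ennreal (pwp_prob lam k)"
  \<comment> \<open>Reindexing by \<open>Suc\<close> turns the integral over the positive integers
    into the series of \<open>pwp_prob_sums\<close>.\<close>
  have bij: "bij_betw Suc UNIV {1..}"
    by (auto simp: bij_betw_def image_iff Suc_le_D)
  have "emeasure (point_measure {1..} ?p) {1..} = (\<integral>\<^sup>+k. ?p k \<partial>count_space {1..})"
    by (auto simp: point_measure_def emeasure_density intro!: nn_integral_cong)
  also have "\<dots> = (\<Sum>k. ?p (Suc k))"
    by (simp only: nn_integral_bij_count_space[OF bij, symmetric] nn_integral_count_space_nat)
  also have "\<dots> = ennreal (\<Sum>k. pwp_prob lam (Suc k))"
    using assms pwp_prob_sums by (intro suminf_ennreal2) (auto simp: pwp_prob_nonneg sums_iff)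
  also have "\<dots> = 1"
    using pwp_prob_sums[OF assms] by (simp add: sums_iff)
  finally show "emeasure (point_measure {1..} ?p) (space (point_measure {1..} ?p)) = 1"
    by (simp add: space_point_measure)
qed

text \<open>A linear map in finite dimension is continuous, so it can be applied to the series of
  \<open>pwp_sums\<close> term by term.\<close>

lemma pwp_linear_image:
  fixes f :: "real^'m^'m \<Rightarrow> real^'n^'n"
  assumes "linear f" "\<And>k. f (matrix_power C k) = matrix_power D k"
  shows "pwp lam D = f (pwp lam C)"
proof -
  have f: "bounded_linear f"
    using assms(1) by (simp add: linear_conv_bounded_linear)
  show ?thesis
    using bounded_linear.sums[OF f pwp_sums[of lam C]] pwp_sums[of lam D]
    by (simp add: linear_scale[OF assms(1)] assms(2) sums_unique2 del: matrix_power.simps)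
qed

section \<open>Transposition and conjugation\<close>

lemma pwp_transpose: "pwp lam (transpose D) = transpose (pwp lam D)"
proof (rule pwp_linear_image)
  show "linear (transpose :: real^'n^'n \<Rightarrow> real^'n^'n)"
    by (intro linearI) (simp_all add: transpose_def vec_eq_iff)
  show "transpose (matrix_power D k) = matrix_power (transpose D) k" for k
    \<comment> \<open>Transposing reverses the product; a matrix commutes with its own powers, which
      restores the order.\<close>
    by (induction k) (simp_all add: matrix_transpose_mul matrix_power_commute)
qed

lemma matrix_inv_mult_left: "invertible Q \<Longrightarrow> matrix_inv Q ** Q = mat 1"
  and matrix_inv_mult_right: "invertible Q \<Longrightarrow> Q ** matrix_inv Q = mat 1"
  unfolding invertible_def matrix_inv_def by (metis (mono_tags, lifting) someI_ex)+

lemma pwp_conjugate: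
  assumes "invertible Q"
  shows "pwp lam (Q ** C ** matrix_inv Q) = Q ** pwp lam C ** matrix_inv Q"
proof (rule pwp_linear_image[where f = "\<lambda>X. Q ** X ** matrix_inv Q"])
  show "linear (\<lambda>X. Q ** X ** matrix_inv Q)"
    by (intro linearI)
       (simp_all add: matrix_mult.add_left matrix_mult.add_right matrix_mult.scaleR_left
         matrix_mult.scaleR_right)
  show "Q ** matrix_power C k ** matrix_inv Q = matrix_power (Q ** C ** matrix_inv Q) k" for k
  proof (induction k)
    case 0
    show ?case
      by (simp add: matrix_inv_mult_right assms)
  next
    case (Suc k)
    have "Q ** C ** matrix_inv Q ** (Q ** matrix_power C k ** matrix_inv Q)
        = Q ** C ** (matrix_inv Q ** Q) ** matrix_power C k ** matrix_inv Q"
      by (simp only: matrix_mul_assoc)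
    then show ?case
      by (simp add: matrix_inv_mult_left assms matrix_mul_assoc flip: Suc)
  qed
qed

section \<open>Block sums\<close>

lemma sum_UNIV_Plus:
  "(\<Sum>i\<in>(UNIV :: ('m::finite + 'n::finite) set). f i)
    = (\<Sum>a\<in>UNIV. f (Inl a)) + (\<Sum>b\<in>UNIV. f (Inr b))"
  by (simp add: UNIV_Plus_UNIV[symmetric] sum.Plus del: UNIV_Plus_UNIV)

lemma block_sum_nth:
  "block_sum A B $ Inl a $ Inl a' = A $ a $ a'"
  "block_sum A B $ Inl a $ Inr b' = 0"
  "block_sum A B $ Inr b $ Inl a' = 0"
  "block_sum A B $ Inr b $ Inr b' = B $ b $ b'"
  by (simp_all add: block_sum_def)

lemma block_sum_mult: "block_sum A B ** block_sum A' B' = block_sum (A ** A') (B ** B')"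
  by (simp add: vec_eq_iff matrix_matrix_mult_def block_sum_def sum_UNIV_Plus split: sum.split)

lemma matrix_power_block_sum:
  "matrix_power (block_sum A B) k = block_sum (matrix_power A k) (matrix_power B k)"
proof (induction k)
  case 0
  show ?case
    by (simp add: vec_eq_iff mat_def block_sum_def split: sum.split)
qed (simp add: block_sum_mult)

text \<open>The map \<open>block_sum\<close> takes two matrices, so the series are compared entry by
  entry: diagonal blocks give the series of \<open>A\<close> and \<open>B\<close>, the other blocks
  the zero series.\<close>

lemma pwp_block_sum: "pwp lam (block_sum A B) = block_sum (pwp lam A) (pwp lam B)"
proof -
  have "(\<lambda>k. (pwp_prob lam (Suc k) *\<^sub>R matrix_power (block_sum A B) (Suc k)) $ i $ j)
      sums (block_sum (pwp lam A) (pwp lam B) $ i $ j)" for i j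
    using sums_matrix_nth[OF pwp_sums[of lam A]] sums_matrix_nth[OF pwp_sums[of lam B]]
    by (cases i; cases j)
       (simp_all add: matrix_power_block_sum block_sum_nth del: matrix_power.simps)
  then show ?thesis
    using sums_unique2[OF sums_matrix_nth[OF pwp_sums[of lam "block_sum A B"]]]
    by (simp add: vec_eq_iff)
qed

section \<open>Column stochastic matrices\<close>

lemma column_stochastic_mult:
  assumes "column_stochastic A" "column_stochastic B"
  shows "column_stochastic (A ** B)"
proof -
  have "(\<Sum>i\<in>UNIV. (A ** B) $ i $ j) = 1" for j
  proof -
    have "(\<Sum>i\<in>UNIV. (A ** B) $ i $ j) = (\<Sum>l\<in>UNIV. (\<Sum>i\<in>UNIV. A $ i $ l) * B $ l $ j)"
      by (simp add: matrix_matrix_mult_def sum_distrib_right) (rule sum.swap)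
    then show ?thesis
      using assms by (simp add: column_stochastic_def)
  qed
  moreover have "0 \<le> (A ** B) $ i $ j" for i j
    using assms by (simp add: column_stochastic_def matrix_matrix_mult_def sum_nonneg)
  ultimately show ?thesis
    by (simp add: column_stochastic_def)
qed

lemma column_stochastic_matrix_power:
  assumes "column_stochastic D"
  shows "column_stochastic (matrix_power D k)"
proof (induction k)
  case 0
  show ?case
    by (simp add: column_stochastic_def mat_def)
qed (simp add: column_stochastic_mult assms)

lemma column_stochastic_pwp:
  assumes "0 < lam" "column_stochastic D"
  shows "column_stochastic (pwp lam D)"
proof -
  note power = column_stochastic_matrix_power[OF assms(2), unfolded column_stochastic_def]
  note nth_sums = sums_matrix_nth[OF pwp_sums[of lam D]]
  have "0 \<le> pwp lam D $ i $ j" for i j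
    using power pwp_prob_nonneg[OF assms(1)]
    by (intro sums_le[OF _ sums_zero nth_sums]) (simp del: matrix_power.simps)
  moreover have "(\<Sum>i\<in>UNIV. pwp lam D $ i $ j) = 1" for j
  proof -
    \<comment> \<open>The finite column sum is taken inside the series; columns of powers sum to 1,
      leaving the total mass of the weights.\<close>
    have "(\<lambda>k. \<Sum>i\<in>UNIV. (pwp_prob lam (Suc k) *\<^sub>R matrix_power D (Suc k)) $ i $ j)
        sums (\<Sum>i\<in>UNIV. pwp lam D $ i $ j)"
      by (intro sums_sum nth_sums)
    then have "(\<lambda>k. pwp_prob lam (Suc k)) sums (\<Sum>i\<in>UNIV. pwp lam D $ i $ j)"
      using power by (simp flip: sum_distrib_left del: matrix_power.simps)
    then show ?thesis
      using pwp_prob_sums[OF assms(1)] by (rule sums_unique2)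
  qed
  ultimately show ?thesis
    by (simp add: column_stochastic_def)
qed

text \<open>With \<open>c = exp lam - 1\<close>, the exponential of \<open>lam *\<^sub>R D\<close>
  is \<open>c *\<^sub>R pwp lam D + mat 1\<close>. Expanding the product of two such factors and
  cancelling \<open>mat 1\<close> and \<open>c\<close> gives the formula.\<close>

lemma pwp_add:
  fixes A B :: "real^'n^'n"
  assumes "0 < lam" "commutator A B = 0"
  shows "pwp lam (A + B) = (exp lam - 1) *\<^sub>R (pwp lam A ** pwp lam B) + pwp lam A + pwp lam B"
proof -
  define c where "c = exp lam - 1"
  have "c \<noteq> 0"
    using assms(1) by (simp add: c_def)
  have exp_eq: "matrix_exp (lam *\<^sub>R D) = c *\<^sub>R pwp lam D + mat 1" for D :: "real^'n^'n"
    using \<open>c \<noteq> 0\<close> by (simp add: pwp_def c_def)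
  have "c *\<^sub>R pwp lam (A + B) + mat 1 = (c *\<^sub>R pwp lam A + mat 1) ** (c *\<^sub>R pwp lam B + mat 1)"
    using assms(2) matrix_exp_add[of "lam *\<^sub>R A" "lam *\<^sub>R B"]
    by (simp add: commutator_def matrix_mult.scaleR_left matrix_mult.scaleR_right
        scaleR_right_distrib flip: exp_eq)
  also have "\<dots> = c *\<^sub>R (c *\<^sub>R (pwp lam A ** pwp lam B) + pwp lam A + pwp lam B) + mat 1"
    by (simp add: matrix_mult.add_left matrix_mult.add_right matrix_mult.scaleR_left
        matrix_mult.scaleR_right scaleR_right_distrib)
  finally show ?thesis
    using \<open>c \<noteq> 0\<close> by (simp flip: c_def)
qed

text \<open>Summability accompanies the last identity because \<open>suminf\<close> carries no
  information for a divergent series; the measure statement makes the weights a genuine probability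
  function.\<close>

theorem theorem1:
  fixes lam :: real
  assumes "0 < lam"
  shows
    "((\<forall>D :: real^'n^'n. D = 0 \<longrightarrow> pwp lam D = 0) \<and>
      (\<forall>D :: real^'n^'n. pwp lam (transpose D) = transpose (pwp lam D)))
     \<and>
     (\<forall>(C :: real^'n^'n) (Q :: real^'n^'n). invertible Q \<longrightarrow>
        pwp lam (Q ** C ** matrix_inv Q) = Q ** pwp lam C ** matrix_inv Q)
     \<and>
     (\<forall>(D1 :: real^'m^'m) (D2 :: real^'n^'n).
        pwp lam (block_sum D1 D2) = block_sum (pwp lam D1) (pwp lam D2))
     \<and>
     (\<forall>D :: real^'n^'n. column_stochastic D \<longrightarrow> column_stochastic (pwp lam D))
     \<and>
     (\<forall>(D1 :: real^'n^'n) (D2 :: real^'n^'n). commutator D1 D2 = 0 \<longrightarrow>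
        pwp lam (D1 + D2) =
          (exp lam - 1) *\<^sub>R (pwp lam D1 ** pwp lam D2) + pwp lam D1 + pwp lam D2)
     \<and>
     ((\<forall>k\<ge>1. 0 \<le> pwp_prob lam k) \<and>
      prob_space (point_measure {1..} (\<lambda>k. ennreal (pwp_prob lam k))) \<and>
      (\<forall>D :: real^'n^'n.
         summable (\<lambda>k. pwp_prob lam (Suc k) *\<^sub>R matrix_power D (Suc k)) \<and>
         pwp lam D = expected_matrix (\<lambda>k. matrix_power D k) (pwp_prob lam)))"
proof (intro conjI allI impI)
  show "pwp lam D = 0" if "D = 0" for D :: "real^'n^'n"
    using that by (simp add: pwp_def matrix_exp_zero)
  show "summable (\<lambda>k. pwp_prob lam (Suc k) *\<^sub>R matrix_power D (Suc k))"
    and "pwp lam D = expected_matrix (\<lambda>k. matrix_power D k) (pwp_prob lam)" for D :: "real^'n^'n"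
    using pwp_sums[of lam D] by (simp_all add: sums_iff expected_matrix_def del: matrix_power.simps)
qed (simp_all add: assms pwp_transpose pwp_conjugate pwp_block_sum column_stochastic_pwp pwp_add
    pwp_prob_nonneg prob_space_pwp_prob[simplified])

end
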